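(* If the generalized orthocenter $H$ of $P$ is not a vertex of $ABC$ and $P$ does not lie on $\iota(l_\infty)$, then $\gamma_P=\delta_H$.
   Context: We work in the Euclidean plane extended by its line at infinity $l_\infty$; affine maps are extended to $l_\infty$. $ABC$ is an ordinary non-degenerate triangle; its sides are the lines $BC, CA, AB$. $X_1X_2\cdot Y_1Y_2$ denotes the intersection of two lines. $K$ is the complement map (homothety with center the centroid $G$ and ratio $-1/2$); $K^{-1}(ABC)$ is the anticomplementary triangle. $\iota$ is the isotomic map, $(x:y:z)\mapsto(1/x:1/y:1/z)$ in barycentric coordinates; $\iota(l_\infty)$ is the Steiner circumellipse. $P$ is a point (ordinary or infinite) not on the sides of $ABC$ or $K^{-1}(ABC)$; $P'=\iota(P)$, $Q=K(P')$, and $D=AP\cdot BC$, $E=BP\cdot CA$, $F=CP\cdot AB$. The generalized orthocenter $H$ of $P$ is the common point of the lines through $A,B,C$ parallel, respectively, to $QD,QE,QF$. Generalized isogonal map $\gamma_P$: let $h_a$ be the affine reflection about the line $AQ$ in the direction of $EF$ (i.e. $h_a(X)=X'$ with $XX'\parallel EF$ and the midpoint of $XX'$ on $AQ$), $h_b$ the affine reflection about $BQ$ in the direction $DF$, and $h_c$ the affine reflection about $CQ$ in the direction $DE$. For $X\neq A,B,C$, $\gamma_P(X)$ is the common point of the lines $Ah_a(X),Bh_b(X),Ch_c(X)$ (which are concurrent). The map $\delta_R$, for a point $R$ not on the sides of $ABC$ or $K^{-1}(ABC)$: let $T_R$ be the affine map taking $A,B,C$ to the vertices $AR\cdot BC$,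 $BR\cdot CA$, $CR\cdot AB$ of the cevian triangle of $R$. For $Y\neq A,B,C$, with traces $D^*=AY\cdot BC$, $E^*=BY\cdot CA$, $F^*=CY\cdot AB$, $\delta_R(Y)$ is the common point of the lines $A\,T_R(D^* )$, $B\,T_R(E^* )$, $C\,T_R(F^* )$ (which are concurrent). Under the hypotheses of the claim, $H$ does not lie on the sides of $ABC$ or $K^{-1}(ABC)$, so $\delta_H$ is defined. *)

theory Defs
  imports "HOL-Analysis.Analysis"
begin

section \<open>The Euclidean plane extended by its line at infinity\<close>

text \<open>
  A point of the extended plane is a one-dimensional subspace of \<open>\<real>\<^sup>2 \<times> \<real>\<close>
  (homogeneous coordinates): the ordinary point \<open>p\<close> is the span of \<open>(p, 1)\<close>, and the
  infinite point in the direction \<open>v \<noteq> 0\<close> is the span of \<open>(v, 0)\<close>.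
\<close>

typedef xpoint = "{S :: ((real^2) \<times> real) set. subspace S \<and> dim S = 1}"
proof -
  have "dim {(0 :: real^2, 1 :: real)} = 1"
    by (subst dim_singleton) (auto simp: zero_prod_def)
  then have "span {(0 :: real^2, 1 :: real)} \<in> {S. subspace S \<and> dim S = 1}"
    by simp
  then show ?thesis by blast
qed

definition Pt :: "real^2 \<Rightarrow> xpoint" where
  "Pt p = Abs_xpoint (span {(p, 1)})"

definition l_inf :: "xpoint set" where
  "l_inf = {X. \<forall>u \<in> Rep_xpoint X. snd u = 0}"

text \<open>The line joining two distinct points, and the intersection of two distinct lines.\<close>

definition join :: "xpoint \<Rightarrow> xpoint \<Rightarrow> xpoint set" where
  "join X Y = {Z. Rep_xpoint Z \<subseteq> span (Rep_xpoint X \<union> Rep_xpoint Y)}"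

definition meet :: "xpoint set \<Rightarrow> xpoint set \<Rightarrow> xpoint" where
  "meet l m = (THE X. X \<in> l \<and> X \<in> m)"

text \<open>The parallel to the line \<open>l \<noteq> l_inf\<close> through the ordinary point \<open>p\<close>.\<close>

definition parallel_through :: "real^2 \<Rightarrow> xpoint set \<Rightarrow> xpoint set" where
  "parallel_through p l = join (Pt p) (meet l l_inf)"

definition affine_map :: "(real^2 \<Rightarrow> real^2) \<Rightarrow> bool" where
  "affine_map f \<longleftrightarrow> (\<exists>L b. linear L \<and> (\<forall>p. f p = L p + b))"

text \<open>
  The extension of a bijective affine map \<open>f p = L p + b\<close> to the extended plane, induced by
  \<open>(v, t) \<mapsto> (L v + t b, t)\<close>; so \<open>Pt p\<close> goes to \<open>Pt (f p)\<close>, and the infinite point in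
  direction \<open>v\<close> to the one in direction \<open>L v\<close>.
\<close>

definition extend :: "(real^2 \<Rightarrow> real^2) \<Rightarrow> xpoint \<Rightarrow> xpoint" where
  "extend f X = Abs_xpoint ((\<lambda>(v, t). (f v - f 0 + t *\<^sub>R f 0, t)) ` Rep_xpoint X)"

section \<open>The triangle, the complement map and the isotomic map\<close>

definition sides :: "real^2 \<Rightarrow> real^2 \<Rightarrow> real^2 \<Rightarrow> xpoint set" where
  "sides A B C = join (Pt B) (Pt C) \<union> join (Pt C) (Pt A) \<union> join (Pt A) (Pt B)"

definition centroid :: "real^2 \<Rightarrow> real^2 \<Rightarrow> real^2 \<Rightarrow> real^2" where
  "centroid A B C = (1/3) *\<^sub>R (A + B + C)"

definition complement :: "real^2 \<Rightarrow> real^2 \<Rightarrow> real^2 \<Rightarrow> real^2 \<Rightarrow> real^2" where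
  "complement A B C p = centroid A B C + (-1/2) *\<^sub>R (p - centroid A B C)"

definition anticompl_sides :: "real^2 \<Rightarrow> real^2 \<Rightarrow> real^2 \<Rightarrow> xpoint set" where
  "anticompl_sides A B C =
     (let K' = inv (complement A B C) in sides (K' A) (K' B) (K' C))"

text \<open>
  \<open>(x : y : z)\<close> are homogeneous barycentric coordinates of \<open>X\<close>: if \<open>x + y + z \<noteq> 0\<close>,
  \<open>X\<close> is the ordinary point \<open>(x A + y B + z C) / (x + y + z)\<close>; if \<open>x + y + z = 0\<close>, it is the
  infinite point in the direction \<open>x A + y B + z C\<close>.
\<close>

definition barycentric ::
  "real^2 \<Rightarrow> real^2 \<Rightarrow> real^2 \<Rightarrow> xpoint \<Rightarrow> real \<Rightarrow> real \<Rightarrow> real \<Rightarrow> bool" where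
  "barycentric A B C X x y z \<longleftrightarrow>
     (x, y, z) \<noteq> (0, 0, 0) \<and>
     (x *\<^sub>R A + y *\<^sub>R B + z *\<^sub>R C, x + y + z) \<in> Rep_xpoint X"

text \<open>
  \<open>(1/x : 1/y : 1/z)\<close> is written as \<open>(y z : z x : x y)\<close>, which also makes sense when exactly one
  coordinate vanishes: points on a side other than the vertices go to the opposite vertex. In
  particular the infinite points of the three sides go to the vertices, so that the
  image of \<open>l_inf\<close> is the whole Steiner circumellipse \<open>y z + z x + x y = 0\<close>.
\<close>

definition isotomic :: "real^2 \<Rightarrow> real^2 \<Rightarrow> real^2 \<Rightarrow> xpoint \<Rightarrow> xpoint" where
  "isotomic A B C X = (THE Y. \<exists>x y z. barycentric A B C X x y z \<and>
                                      barycentric A B C Y (y * z) (z * x) (x * y))"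

definition isotomcomplement :: "real^2 \<Rightarrow> real^2 \<Rightarrow> real^2 \<Rightarrow> xpoint \<Rightarrow> xpoint" where
  "isotomcomplement A B C P = extend (complement A B C) (isotomic A B C P)"

text \<open>\<open>cevian_trace A B C X\<close> is \<open>AX \<cdot> BC\<close>; the other two traces are obtained by cyclic permutation.\<close>

definition cevian_trace :: "real^2 \<Rightarrow> real^2 \<Rightarrow> real^2 \<Rightarrow> xpoint \<Rightarrow> xpoint" where
  "cevian_trace A B C X = meet (join (Pt A) X) (join (Pt B) (Pt C))"

definition gen_orthocenter :: "real^2 \<Rightarrow> real^2 \<Rightarrow> real^2 \<Rightarrow> xpoint \<Rightarrow> xpoint" where
  "gen_orthocenter A B C P =
     (let Q = isotomcomplement A B C P;
          D = cevian_trace A B C P; E = cevian_trace B C A P; F = cevian_trace C A B P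
      in THE H. H \<in> parallel_through A (join Q D) \<and>
                H \<in> parallel_through B (join Q E) \<and>
                H \<in> parallel_through C (join Q F))"

section \<open>The generalized isogonal map\<close>

text \<open>The affine reflection about the ordinary line \<open>l\<close> in the direction of the line \<open>m\<close>.\<close>

definition affine_reflection :: "xpoint set \<Rightarrow> xpoint set \<Rightarrow> real^2 \<Rightarrow> real^2" where
  "affine_reflection l m p =
     (THE p'. Pt p' \<in> parallel_through p m \<and> Pt (midpoint p p') \<in> l)"

definition gen_isogonal :: "real^2 \<Rightarrow> real^2 \<Rightarrow> real^2 \<Rightarrow> xpoint \<Rightarrow> xpoint \<Rightarrow> xpoint" where
  "gen_isogonal A B C P X =
     (let Q = isotomcomplement A B C P;
          D = cevian_trace A B C P; E = cevian_trace B C A P; F = cevian_trace C A B P;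
          h\<^sub>a = affine_reflection (join (Pt A) Q) (join E F);
          h\<^sub>b = affine_reflection (join (Pt B) Q) (join D F);
          h\<^sub>c = affine_reflection (join (Pt C) Q) (join D E)
      in THE Z. Z \<in> join (Pt A) (extend h\<^sub>a X) \<and>
                Z \<in> join (Pt B) (extend h\<^sub>b X) \<and>
                Z \<in> join (Pt C) (extend h\<^sub>c X))"

section \<open>The map \<open>\<delta>\<close>\<close>

definition cevian_map :: "real^2 \<Rightarrow> real^2 \<Rightarrow> real^2 \<Rightarrow> xpoint \<Rightarrow> real^2 \<Rightarrow> real^2" where
  "cevian_map A B C R =
     (THE T. affine_map T \<and> Pt (T A) = cevian_trace A B C R \<and>
             Pt (T B) = cevian_trace B C A R \<and> Pt (T C) = cevian_trace C A B R)"

definition delta :: "real^2 \<Rightarrow> real^2 \<Rightarrow> real^2 \<Rightarrow> xpoint \<Rightarrow> xpoint \<Rightarrow> xpoint" where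
  "delta A B C R Y =
     (let T = extend (cevian_map A B C R)
      in THE Z. Z \<in> join (Pt A) (T (cevian_trace A B C Y)) \<and>
                Z \<in> join (Pt B) (T (cevian_trace B C A Y)) \<and>
                Z \<in> join (Pt C) (T (cevian_trace C A B Y)))"

end

theory Submission
  imports Defs
begin

text \<open>
  Let \<open>P = (p : q : r)\<close> in barycentric coordinates and \<open>\<sigma> = p q + q r + r p\<close>. Then \<open>Q = (a : b : c)\<close> with
  \<open>a = p (q + r)\<close>, \<open>b = q (r + p)\<close>, \<open>c = r (p + q)\<close>. On the pencil of lines through \<open>A\<close>, the reflection \<open>h\<^sub>a\<close>
  fixes the direction \<open>(b, c)\<close> of \<open>A Q\<close> and negates the direction \<open>(b, -c)\<close> of \<open>E F\<close>; hence it exchanges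
  \<open>y / b\<close> and \<open>z / c\<close>, and the generalized isogonal map is
  \<open>(x : y : z) \<mapsto> (a\<^sup>2 / x : b\<^sup>2 / y : c\<^sup>2 / z)\<close> (lemma \<open>join_vertex_reflection\<close>).

  For a point \<open>R = (u : v : w)\<close>, the affine map onto the cevian triangle of \<open>R\<close> sends the trace \<open>(0 : y : z)\<close>
  to a point on the line through \<open>A\<close> with ratio \<open>v (w + u) / y : w (u + v) / z\<close>. So the map \<open>\<delta>\<close> of \<open>R\<close> is
  \<open>(x : y : z) \<mapsto> (u (v + w) / x : v (w + u) / y : w (u + v) / z)\<close> (lemma \<open>join_vertex_cevian_map\<close>).

  The generalized orthocenter is \<open>H = (p / (p\<^sup>2 - \<sigma>) : q / (q\<^sup>2 - \<sigma>) : r / (r\<^sup>2 - \<sigma>))\<close> (lemmas \<open>altitude\<close>,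
  \<open>gen_orthocenter_bpt\<close>); it is a vertex when one of the denominators is zero (lemma
  \<open>ortho_is_vertex\<close>), and otherwise \<open>u (v + w) : v (w + u) : w (u + v) = a\<^sup>2 : b\<^sup>2 : c\<^sup>2\<close> for \<open>R = H\<close>. Therefore the two
  maps have the same formula. In the proof this is used in the form that the three lines whose common
  point defines \<open>\<gamma>\<close> are the three lines whose common point defines \<open>\<delta>\<close> (lemma
  \<open>cevian_lines_agree\<close>, applied at each vertex); their common point is then the same as well.
\<close>

section \<open>Homogeneous coordinates\<close>

definition hpoint :: "(real^2) \<times> real \<Rightarrow> xpoint" where
  "hpoint u = Abs_xpoint (span {u})"

lemma Rep_hpoint:
  assumes "u \<noteq> 0" shows "Rep_xpoint (hpoint u) = span {u}"
proof -
  have "dim {u} = 1" using assms by (subst dim_singleton) auto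
  then show ?thesis unfolding hpoint_def by (subst Abs_xpoint_inverse) auto
qed

lemma xpoint_cases:
  obtains u where "u \<noteq> 0" "X = hpoint u"
proof -
  have S: "subspace (Rep_xpoint X)" "dim (Rep_xpoint X) = 1"
    using Rep_xpoint[of X] by auto
  obtain B where B: "B \<subseteq> Rep_xpoint X" "independent B" "Rep_xpoint X \<subseteq> span B" "card B = 1"
    using basis_exists[of "Rep_xpoint X"] S(2) by metis
  then obtain u where u: "B = {u}" by (meson card_1_singletonE)
  have "u \<noteq> 0" using B(2) u dependent_zero by blast
  moreover have "Rep_xpoint X = span {u}"
    using B u S(1) by (metis span_minimal subset_antisym)
  then have "X = hpoint u" unfolding hpoint_def by (metis Rep_xpoint_inverse)
  ultimately show ?thesis using that by blast
qed

lemma mem_Rep_hpoint: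
  assumes "u \<noteq> 0" shows "w \<in> Rep_xpoint (hpoint u) \<longleftrightarrow> (\<exists>k. w = k *\<^sub>R u)"
  using assms by (auto simp: Rep_hpoint span_singleton)

lemma hpoint_scale:
  assumes "k \<noteq> 0" shows "hpoint (k *\<^sub>R u) = hpoint u"
proof -
  have "span {k *\<^sub>R u} = span {u}"
  proof
    show "span {k *\<^sub>R u} \<subseteq> span {u}" by (rule span_minimal) (auto intro: span_scale span_base)
    have "(1/k) *\<^sub>R (k *\<^sub>R u) \<in> span {k *\<^sub>R u}" by (intro span_scale span_base) auto
    then have "u \<in> span {k *\<^sub>R u}" using assms by simp
    then show "span {u} \<subseteq> span {k *\<^sub>R u}" by (simp add: span_minimal)
  qed
  then show ?thesis by (simp add: hpoint_def)
qed

lemma hpoint_eqE: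
  assumes "hpoint u = hpoint v" "u \<noteq> 0" "v \<noteq> 0"
  obtains k where "k \<noteq> 0" "v = k *\<^sub>R u"
proof -
  have "v \<in> Rep_xpoint (hpoint u)" using assms by (simp add: Rep_hpoint span_base)
  then obtain k where "v = k *\<^sub>R u" using assms mem_Rep_hpoint by blast
  with that assms show ?thesis by auto
qed

text \<open>
  This turns the subspace definition of a line into a linear combination of representatives;
  everything below about joins is derived from it.
\<close>

lemma mem_join_hpoint:
  assumes "u \<noteq> 0" "v \<noteq> 0" "w \<noteq> 0"
  shows "hpoint w \<in> join (hpoint u) (hpoint v) \<longleftrightarrow> (\<exists>s t. w = s *\<^sub>R u + t *\<^sub>R v)"
proof -
  have "span {w} \<subseteq> span S \<longleftrightarrow> w \<in> span S" for S
    using span_minimal[OF _ subspace_span, of "{w}" S] span_base[of w "{w}"] by blast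
  moreover have "span (span {u} \<union> span {v}) = span ({u} \<union> {v})"
    unfolding span_Un span_span ..
  moreover have "w \<in> span {u, v} \<longleftrightarrow> (\<exists>s t. w = s *\<^sub>R u + t *\<^sub>R v)"
    unfolding span_breakdown_eq[of w u] span_singleton by (simp add: image_iff diff_eq_eq add.commute)
  moreover have "{u} \<union> {v} = {u, v}" by blast
  ultimately show ?thesis using assms by (simp add: join_def Rep_hpoint)
qed

lemma join_commute: "join X Y = join Y X"
  by (simp add: join_def Un_commute)

lemma hpoint_in_l_inf:
  assumes "u \<noteq> 0" shows "hpoint u \<in> l_inf \<longleftrightarrow> snd u = 0"
  using assms by (auto simp: l_inf_def Rep_hpoint span_singleton dest: spec[of _ 1])

lemma Pt_hpoint: "Pt p = hpoint (p, 1)"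
  by (simp add: Pt_def hpoint_def)

lemma Pt_inject: "Pt p = Pt q \<longleftrightarrow> p = q"
proof
  assume "Pt p = Pt q"
  then obtain k where "(q, 1) = k *\<^sub>R (p, 1::real)"
    by (metis Pt_hpoint hpoint_eqE prod.inject zero_neq_one zero_prod_def)
  then show "p = q" by auto
qed simp

lemma sum_squares_nonzero:
  fixes a b c :: real
  assumes "(a, b, c) \<noteq> 0" shows "a\<^sup>2 + b\<^sup>2 + c\<^sup>2 \<noteq> 0"
proof
  assume "a\<^sup>2 + b\<^sup>2 + c\<^sup>2 = 0"
  moreover have "0 \<le> a\<^sup>2" "0 \<le> b\<^sup>2" "0 \<le> c\<^sup>2" by simp_all
  ultimately have "a\<^sup>2 = 0" "b\<^sup>2 = 0" "c\<^sup>2 = 0" by linarith+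
  with assms show False by (simp add: zero_prod_def)
qed

section \<open>Points and lines in barycentric coordinates\<close>

text \<open>
  All constructions are translated into homogeneous barycentric coordinates. That every point of the
  extended plane has such coordinates, unique up to a factor, is exactly the bijectivity of the
  linear map \<open>lift\<close>, that is, the independence of the vectors \<open>(A, 1)\<close>, \<open>(B, 1)\<close>, \<open>(C, 1)\<close>.
  Ordinary and infinite points then need no separate treatment.
\<close>

locale triangle =
  fixes A B C :: "real^2"
  assumes nondegenerate: "\<not> collinear {A, B, C}"
begin

definition lift :: "real \<times> real \<times> real \<Rightarrow> (real^2) \<times> real" where
  "lift = (\<lambda>(x, y, z). (x *\<^sub>R A + y *\<^sub>R B + z *\<^sub>R C, x + y + z))"

lemma linear_lift: "linear lift"
  unfolding lift_def by (rule linearI) (auto simp: algebra_simps)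

lemma inj_lift: "inj lift"
proof -
  have "v = 0" if "lift v = 0" for v
  proof -
    obtain x y z where v: "v = (x, y, z)" by (cases v)
    have 1: "x *\<^sub>R A + y *\<^sub>R B + z *\<^sub>R C = 0" "x = - y - z"
      using that by (auto simp: v lift_def zero_prod_def)
    then have 2: "y *\<^sub>R (B - A) + z *\<^sub>R (C - A) = 0" by (simp add: algebra_simps)
    have nc: "\<not> collinear {0, B - A, C - A}"
      using nondegenerate collinear_3[of B A C] by (auto simp: insert_commute collinear_def)
    have "z = 0"
    proof (rule ccontr)
      assume "z \<noteq> 0"
      have "C - A = (1/z) *\<^sub>R (z *\<^sub>R (C - A))" using \<open>z \<noteq> 0\<close> by simp
      also have "z *\<^sub>R (C - A) = - y *\<^sub>R (B - A)" using 2 by (simp add: add_eq_0_iff)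
      finally have "C - A = (- y / z) *\<^sub>R (B - A)" by simp
      then show False using nc collinear_lemma by blast
    qed
    moreover have "B - A \<noteq> 0" using nc collinear_lemma by blast
    ultimately show ?thesis using 1 2 v by (auto simp: zero_prod_def)
  qed
  then show ?thesis using linear_lift linear_injective_0 by blast
qed

lemma surj_lift: "surj lift"
  by (rule linear_injective_imp_surjective[OF linear_lift inj_lift]) simp

definition bpt :: "real \<Rightarrow> real \<Rightarrow> real \<Rightarrow> xpoint" where
  "bpt x y z = hpoint (lift (x, y, z))"

definition bline :: "real \<Rightarrow> real \<Rightarrow> real \<Rightarrow> xpoint set" where
  "bline l m n = {bpt x y z |x y z. (x, y, z) \<noteq> 0 \<and> l * x + m * y + n * z = 0}"

lemma lift_eq_0_iff: "lift v = 0 \<longleftrightarrow> v = 0"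
  using inj_lift linear_lift by (metis injD linear_0)

lemma bpt_cases:
  obtains x y z where "(x, y, z) \<noteq> 0" "X = bpt x y z"
proof -
  obtain u where u: "u \<noteq> 0" "X = hpoint u" by (rule xpoint_cases)
  obtain v where v: "lift v = u" using surj_lift by (metis surjD)
  obtain x y z where "v = (x, y, z)" by (cases v)
  with that u v show ?thesis by (metis bpt_def lift_eq_0_iff)
qed

lemma set_eqI_bpt:
  assumes "\<And>x y z. (x, y, z) \<noteq> 0 \<Longrightarrow> bpt x y z \<in> S \<longleftrightarrow> bpt x y z \<in> T"
  shows "S = T"
proof (rule set_eqI)
  fix X
  obtain x y z where "(x, y, z) \<noteq> 0" "X = bpt x y z" by (rule bpt_cases)
  with assms show "X \<in> S \<longleftrightarrow> X \<in> T" by blast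
qed

lemma bpt_scale: "k \<noteq> 0 \<Longrightarrow> bpt (k * x) (k * y) (k * z) = bpt x y z"
  using hpoint_scale[of k "lift (x, y, z)"] linear_scale[OF linear_lift, of k "(x, y, z)"]
  by (simp add: bpt_def)

lemma bpt_eqE:
  assumes "bpt x y z = bpt x' y' z'" "(x, y, z) \<noteq> 0" "(x', y', z') \<noteq> 0"
  obtains k where "k \<noteq> 0" "x' = k * x" "y' = k * y" "z' = k * z"
proof -
  obtain k where k: "k \<noteq> 0" "lift (x', y', z') = k *\<^sub>R lift (x, y, z)"
    using assms hpoint_eqE unfolding bpt_def by (metis lift_eq_0_iff)
  then have "lift (x', y', z') = lift (k * x, k * y, k * z)"
    using linear_scale[OF linear_lift, of k "(x, y, z)"] by simp
  then have "(x', y', z') = (k * x, k * y, k * z)" using inj_lift by (meson injD)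
  with k that show ?thesis by auto
qed

lemma bpt_in_bline:
  assumes "(x, y, z) \<noteq> 0"
  shows "bpt x y z \<in> bline l m n \<longleftrightarrow> l * x + m * y + n * z = 0"
proof
  assume "bpt x y z \<in> bline l m n"
  then obtain x' y' z' where e: "bpt x' y' z' = bpt x y z" "(x', y', z') \<noteq> 0"
    and l: "l * x' + m * y' + n * z' = 0" unfolding bline_def by force
  obtain k where "x = k * x'" "y = k * y'" "z = k * z'" using bpt_eqE[OF e assms] .
  then have "l * x + m * y + n * z = k * (l * x' + m * y' + n * z')" by (simp add: algebra_simps)
  with l show "l * x + m * y + n * z = 0" by simp
qed (use assms in \<open>auto simp: bline_def\<close>)

lemma bline_scale:
  assumes "k \<noteq> 0" shows "bline (k * l) (k * m) (k * n) = bline l m n"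
proof -
  have "k * l * x + k * m * y + k * n * z = k * (l * x + m * y + n * z)" for x y z
    by (simp add: algebra_simps)
  with assms show ?thesis by (simp add: bline_def)
qed

lemma bpt_in_join:
  assumes "(x, y, z) \<noteq> 0" "(x', y', z') \<noteq> 0" "(x'', y'', z'') \<noteq> 0"
  shows "bpt x'' y'' z'' \<in> join (bpt x y z) (bpt x' y' z') \<longleftrightarrow>
    (\<exists>s t. x'' = s * x + t * x' \<and> y'' = s * y + t * y' \<and> z'' = s * z + t * z')"
proof -
  have "lift (x'', y'', z'') = s *\<^sub>R lift (x, y, z) + t *\<^sub>R lift (x', y', z') \<longleftrightarrow>
     x'' = s * x + t * x' \<and> y'' = s * y + t * y' \<and> z'' = s * z + t * z'" for s t
  proof -
    have "s *\<^sub>R lift (x, y, z) + t *\<^sub>R lift (x', y', z')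
        = lift (s *\<^sub>R (x, y, z) + t *\<^sub>R (x', y', z'))"
      by (simp only: linear_add[OF linear_lift] linear_scale[OF linear_lift])
    then show ?thesis using inj_lift by (auto simp: inj_eq)
  qed
  then show ?thesis using assms unfolding bpt_def
    by (subst mem_join_hpoint) (auto simp: lift_eq_0_iff)
qed

text \<open>
  The join of two points has their cross product as coordinates. With \<open>n = u \<times> v \<noteq> 0\<close> and
  \<open>N = n \<bullet> n\<close>, a vector \<open>w\<close> orthogonal to \<open>n\<close> is the combination
  \<open>N w = ((v \<times> n) \<bullet> w) u + ((n \<times> u) \<bullet> w) v\<close> of \<open>u\<close> and \<open>v\<close>.
\<close>

lemma join_eq_bline:
  assumes "(y * z' - z * y', z * x' - x * z', x * y' - y * x') \<noteq> 0"
  shows "join (bpt x y z) (bpt x' y' z') =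
           bline (y * z' - z * y') (z * x' - x * z') (x * y' - y * x')"
proof -
  define a b c where abc: "a = y * z' - z * y'" "b = z * x' - x * z'" "c = x * y' - y * x'"
  have 0: "(x, y, z) \<noteq> 0" "(x', y', z') \<noteq> 0"
  proof -
    have "(a, b, c) = 0" if "(x, y, z) = 0 \<or> (x', y', z') = 0"
      using that unfolding abc zero_prod_def by auto
    with assms show "(x, y, z) \<noteq> 0" "(x', y', z') \<noteq> 0" unfolding abc by blast+
  qed
  define N where "N = a\<^sup>2 + b\<^sup>2 + c\<^sup>2"
  have N: "N \<noteq> 0" using assms unfolding N_def abc[symmetric]
    by (rule sum_squares_nonzero)
  have "(\<exists>s t. x'' = s * x + t * x' \<and> y'' = s * y + t * y' \<and> z'' = s * z + t * z')
     \<longleftrightarrow> a * x'' + b * y'' + c * z'' = 0" for x'' y'' z''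
  proof
    assume L: "a * x'' + b * y'' + c * z'' = 0"
    \<comment> \<open>Coefficients obtained from the triple products in the identity above.\<close>
    define s where "s = x'' * (y' * c - z' * b) + y'' * (z' * a - x' * c) + z'' * (x' * b - y' * a)"
    define t where "t = x'' * (b * z - c * y) + y'' * (c * x - a * z) + z'' * (a * y - b * x)"
    have "N * x'' = s * x + t * x' + (a * x'' + b * y'' + c * z'') * a"
      "N * y'' = s * y + t * y' + (a * x'' + b * y'' + c * z'') * b"
      "N * z'' = s * z + t * z' + (a * x'' + b * y'' + c * z'') * c"
      unfolding N_def s_def t_def abc by algebra+
    then have "x'' = s / N * x + t / N * x'" "y'' = s / N * y + t / N * y'"
      "z'' = s / N * z + t / N * z'"
      unfolding L using N by (simp_all add: field_simps)
    then show "\<exists>s t. x'' = s * x + t * x' \<and> y'' = s * y + t * y' \<and> z'' = s * z + t * z'"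
      by blast
  next
    assume "\<exists>s t. x'' = s * x + t * x' \<and> y'' = s * y + t * y' \<and> z'' = s * z + t * z'"
    then obtain s t where st: "x'' = s * x + t * x'" "y'' = s * y + t * y'" "z'' = s * z + t * z'"
      by blast
    show "a * x'' + b * y'' + c * z'' = 0" unfolding abc st by algebra
  qed
  then have "bpt x'' y'' z'' \<in> join (bpt x y z) (bpt x' y' z') \<longleftrightarrow> bpt x'' y'' z'' \<in> bline a b c"
    if "(x'', y'', z'') \<noteq> 0" for x'' y'' z''
    unfolding bpt_in_join[OF 0 that] bpt_in_bline[OF that] .
  then have "join (bpt x y z) (bpt x' y' z') = bline a b c"
    by (rule set_eqI_bpt)
  then show ?thesis unfolding abc .
qed

text \<open>
  Dually, two different lines meet exactly in the cross product \<open>n\<close> of their coordinates: a vector \<open>v\<close>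
  orthogonal to both is parallel to \<open>n\<close>, so \<open>(n \<bullet> n) v = (n \<bullet> v) n\<close>.
\<close>

lemma blines_meet:
  assumes "(m * n' - n * m', n * l' - l * n', l * m' - m * l') \<noteq> 0"
  shows "X \<in> bline l m n \<and> X \<in> bline l' m' n' \<longleftrightarrow>
           X = bpt (m * n' - n * m') (n * l' - l * n') (l * m' - m * l')"
proof
  define a b c where abc: "a = m * n' - n * m'" "b = n * l' - l * n'" "c = l * m' - m * l'"
  define N where "N = a\<^sup>2 + b\<^sup>2 + c\<^sup>2"
  have N: "N \<noteq> 0" using assms unfolding N_def abc[symmetric]
    by (rule sum_squares_nonzero)
  obtain x y z where X: "(x, y, z) \<noteq> 0" "X = bpt x y z" by (rule bpt_cases)
  define s where "s = a * x + b * y + c * z"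
  assume "X \<in> bline l m n \<and> X \<in> bline l' m' n'"
  then have e: "l * x + m * y + n * z = 0" "l' * x + m' * y + n' * z = 0"
    using X by (auto simp: bpt_in_bline)
  have "a * y = b * x" "a * z = c * x" "b * z = c * y" using e unfolding abc by algebra+
  then have "N * x = s * a" "N * y = s * b" "N * z = s * c"
    unfolding N_def s_def by algebra+
  then have *: "x = s / N * a" "y = s / N * b" "z = s / N * c" using N by (auto simp: field_simps)
  then have "s \<noteq> 0" using X by (auto simp: zero_prod_def)
  then have "X = bpt a b c" using X * N bpt_scale[of "s / N" a b c] by auto
  then show "X = bpt (m * n' - n * m') (n * l' - l * n') (l * m' - m * l')" unfolding abc .
next
  assume "X = bpt (m * n' - n * m') (n * l' - l * n') (l * m' - m * l')"
  then show "X \<in> bline l m n \<and> X \<in> bline l' m' n'"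
    using assms by (simp add: bpt_in_bline algebra_simps)
qed

lemma meet_bline:
  assumes "(m * n' - n * m', n * l' - l * n', l * m' - m * l') \<noteq> 0"
  shows "meet (bline l m n) (bline l' m' n') =
           bpt (m * n' - n * m') (n * l' - l * n') (l * m' - m * l')"
  unfolding meet_def using blines_meet[OF assms] by simp

lemma l_inf_eq_bline: "l_inf = bline 1 1 1"
proof -
  have "bpt x y z \<in> l_inf \<longleftrightarrow> bpt x y z \<in> bline 1 1 1" if "(x, y, z) \<noteq> 0" for x y z
  proof -
    have "bpt x y z \<in> l_inf \<longleftrightarrow> snd (lift (x, y, z)) = 0"
      unfolding bpt_def using that by (subst hpoint_in_l_inf) (auto simp: lift_eq_0_iff)
    with that show ?thesis by (simp add: bpt_in_bline lift_def)
  qed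
  then show ?thesis by (rule set_eqI_bpt)
qed

lemma Pt_eq_bpt:
  assumes "x + y + z = 1" shows "Pt (x *\<^sub>R A + y *\<^sub>R B + z *\<^sub>R C) = bpt x y z"
  using assms by (simp add: Pt_hpoint bpt_def lift_def)

lemma Pt_vertices: "Pt A = bpt 1 0 0" "Pt B = bpt 0 1 0" "Pt C = bpt 0 0 1"
  using Pt_eq_bpt[of 1 0 0] Pt_eq_bpt[of 0 1 0] Pt_eq_bpt[of 0 0 1] by simp_all

text \<open>
  An affine map acts linearly on homogeneous coordinates, so that its extension is determined by the
  images of the vertices.
\<close>

lemma extend_affine:
  assumes "affine_map f" "(x, y, z) \<noteq> 0"
  shows "extend f (bpt x y z) = hpoint (x *\<^sub>R f A + y *\<^sub>R f B + z *\<^sub>R f C, x + y + z)"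
proof -
  obtain L b where L: "linear L" and f: "\<And>p. f p = L p + b"
    using assms by (auto simp: affine_map_def)
  define F :: "(real^2) \<times> real \<Rightarrow> (real^2) \<times> real"
    where "F = (\<lambda>(v, t). (f v - f 0 + t *\<^sub>R f 0, t))"
  have F: "linear F"
    unfolding F_def f by (rule linearI)
      (auto simp: linear_0[OF L] linear_add[OF L] linear_scale[OF L] algebra_simps)
  have "F (lift (x, y, z)) = (x *\<^sub>R f A + y *\<^sub>R f B + z *\<^sub>R f C, x + y + z)"
    by (simp add: F_def lift_def f linear_0[OF L] linear_add[OF L] linear_scale[OF L] algebra_simps)
  moreover have "Rep_xpoint (bpt x y z) = span {lift (x, y, z)}"
    unfolding bpt_def using assms(2) by (simp add: Rep_hpoint lift_eq_0_iff)
  moreover have "F ` span {lift (x, y, z)} = span {F (lift (x, y, z))}"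
    using linear_span_image[OF F, of "{lift (x, y, z)}"] by simp
  ultimately show ?thesis
    unfolding extend_def hpoint_def F_def by simp
qed

section \<open>The triangle constructions in coordinates\<close>

lemma barycentric_bpt:
  assumes "(x, y, z) \<noteq> 0"
  shows "barycentric A B C (bpt x y z) x' y' z' \<longleftrightarrow>
    (\<exists>k. k \<noteq> 0 \<and> x' = k * x \<and> y' = k * y \<and> z' = k * z)"
proof -
  have "lift (x', y', z') = k *\<^sub>R lift (x, y, z) \<longleftrightarrow> x' = k * x \<and> y' = k * y \<and> z' = k * z" for k
    using inj_eq[OF inj_lift, of "(x', y', z')" "k *\<^sub>R (x, y, z)"]
    unfolding linear_scale[OF linear_lift] by simp
  moreover have "lift (x', y', z') \<in> Rep_xpoint (bpt x y z) \<longleftrightarrow>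
      (\<exists>k. lift (x', y', z') = k *\<^sub>R lift (x, y, z))"
    unfolding bpt_def using assms by (intro mem_Rep_hpoint) (simp add: lift_eq_0_iff)
  moreover have "lift (x', y', z') = (x' *\<^sub>R A + y' *\<^sub>R B + z' *\<^sub>R C, x' + y' + z')"
    by (simp add: lift_def)
  ultimately have "barycentric A B C (bpt x y z) x' y' z' \<longleftrightarrow>
      (x', y', z') \<noteq> (0, 0, 0) \<and> (\<exists>k. x' = k * x \<and> y' = k * y \<and> z' = k * z)"
    unfolding barycentric_def by simp
  also have "\<dots> \<longleftrightarrow> (\<exists>k. k \<noteq> 0 \<and> x' = k * x \<and> y' = k * y \<and> z' = k * z)"
    using assms by (auto simp: zero_prod_def)
  finally show ?thesis .
qed

lemma isotomic_bpt:
  assumes "x \<noteq> 0" "y \<noteq> 0" "z \<noteq> 0"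
  shows "isotomic A B C (bpt x y z) = bpt (y * z) (z * x) (x * y)"
  unfolding isotomic_def
proof (rule the_equality)
  have "barycentric A B C (bpt x y z) x y z"
    using assms by (subst barycentric_bpt) (auto simp: zero_prod_def intro: exI[of _ 1])
  moreover have "barycentric A B C (bpt (y * z) (z * x) (x * y)) (y * z) (z * x) (x * y)"
    using assms by (subst barycentric_bpt) (auto simp: zero_prod_def intro: exI[of _ 1])
  ultimately show "\<exists>x' y' z'. barycentric A B C (bpt x y z) x' y' z' \<and>
      barycentric A B C (bpt (y * z) (z * x) (x * y)) (y' * z') (z' * x') (x' * y')" by blast
next
  fix Y
  assume "\<exists>x' y' z'. barycentric A B C (bpt x y z) x' y' z' \<and>
      barycentric A B C Y (y' * z') (z' * x') (x' * y')"
  then obtain x' y' z' where 1: "barycentric A B C (bpt x y z) x' y' z'"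
    and 2: "barycentric A B C Y (y' * z') (z' * x') (x' * y')" by blast
  obtain k where k: "k \<noteq> 0" "x' = k * x" "y' = k * y" "z' = k * z"
    using 1 assms by (subst (asm) barycentric_bpt) (auto simp: zero_prod_def)
  obtain a b c where abc: "(a, b, c) \<noteq> 0" "Y = bpt a b c" by (rule bpt_cases)
  obtain j where j: "j \<noteq> 0" "y' * z' = j * a" "z' * x' = j * b" "x' * y' = j * c"
    using 2 abc barycentric_bpt by blast
  have "bpt a b c = bpt (j * a) (j * b) (j * c)" using j(1) by (simp add: bpt_scale)
  also have "\<dots> = bpt (k\<^sup>2 * (y * z)) (k\<^sup>2 * (z * x)) (k\<^sup>2 * (x * y))"
    unfolding j(2-4)[symmetric] k(2-4) by (simp add: power2_eq_square mult_ac)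
  also have "\<dots> = bpt (y * z) (z * x) (x * y)" using k(1) by (simp add: bpt_scale)
  finally show "Y = bpt (y * z) (z * x) (x * y)" using abc by simp
qed

lemma affine_complement: "affine_map (complement A B C)"
proof -
  have "linear (\<lambda>p :: real^2. (-1/2) *\<^sub>R p)" by (rule linearI) (auto simp: algebra_simps)
  moreover have "complement A B C p = (-1/2) *\<^sub>R p + (3/2) *\<^sub>R centroid A B C" for p
    by (simp add: complement_def vec_eq_iff field_simps)
  ultimately show ?thesis unfolding affine_map_def by blast
qed

lemma complement_vertices:
  "complement A B C A = (1/2) *\<^sub>R (B + C)"
  "complement A B C B = (1/2) *\<^sub>R (C + A)"
  "complement A B C C = (1/2) *\<^sub>R (A + B)"
  by (simp_all add: complement_def centroid_def vec_eq_iff field_simps)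

lemma isotomcomplement_bpt:
  assumes "p \<noteq> 0" "q \<noteq> 0" "r \<noteq> 0"
  shows "isotomcomplement A B C (bpt p q r) = bpt (p * (q + r)) (q * (r + p)) (r * (p + q))"
proof -
  have "isotomcomplement A B C (bpt p q r) =
      extend (complement A B C) (bpt (q * r) (r * p) (p * q))"
    using assms by (simp add: isotomcomplement_def isotomic_bpt)
  also have "\<dots> = bpt (1/2 * (p * (q + r))) (1/2 * (q * (r + p))) (1/2 * (r * (p + q)))"
    using assms unfolding bpt_def[of "1/2 * _"]
    by (subst extend_affine[OF affine_complement])
       (simp_all add: zero_prod_def complement_vertices lift_def vec_eq_iff algebra_simps)
  also have "\<dots> = bpt (p * (q + r)) (q * (r + p)) (r * (p + q))" by (rule bpt_scale) simp
  finally show ?thesis .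
qed

lemma rotate: "triangle B C A"
  using nondegenerate by unfold_locales (simp add: insert_commute)

text \<open>
  The problem is symmetric under the cyclic rotation of the vertices. These two lemmas allow
  facts about the vertex \<open>A\<close>, proved for an arbitrary triangle, to be transferred to \<open>B\<close> and \<open>C\<close>.
\<close>

lemma bpt_rotate: "triangle.bpt B C A y z x = bpt x y z"
proof -
  interpret rot: triangle B C A by (rule rotate)
  show ?thesis by (simp add: bpt_def rot.bpt_def lift_def rot.lift_def add_ac)
qed

lemma bline_rotate: "triangle.bline B C A m n l = bline l m n"
proof -
  interpret rot: triangle B C A by (rule rotate)
  show ?thesis
  proof (rule set_eqI_bpt)
    fix x y z :: real
    assume nz: "(x, y, z) \<noteq> 0"
    then have "(y, z, x) \<noteq> 0" by (auto simp: zero_prod_def)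
    from rot.bpt_in_bline[OF this, of m n l]
    show "bpt x y z \<in> rot.bline m n l \<longleftrightarrow> bpt x y z \<in> bline l m n"
      unfolding bpt_rotate bpt_in_bline[OF nz] by (simp add: add_ac)
  qed
qed

text \<open>
  A line through \<open>A\<close> is determined by the ratio of the last two coordinates of any other point on it.
\<close>

lemma join_vertex:
  assumes "y \<noteq> 0 \<or> z \<noteq> 0"
  shows "join (Pt A) (bpt x y z) = bline 0 (- z) y"
  unfolding Pt_vertices using assms by (subst join_eq_bline) (auto simp: zero_prod_def)

lemma cevian_trace_bpt:
  assumes "y \<noteq> 0 \<or> z \<noteq> 0"
  shows "cevian_trace A B C (bpt x y z) = bpt 0 y z"
proof -
  have "join (Pt B) (Pt C) = bline 1 0 0"
    unfolding Pt_vertices by (subst join_eq_bline) (auto simp: zero_prod_def)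
  then show ?thesis
    unfolding cevian_trace_def join_vertex[OF assms]
    using assms by (simp add: meet_bline zero_prod_def)
qed

lemma cevian_traces_bpt:
  assumes "x \<noteq> 0" "y \<noteq> 0" "z \<noteq> 0"
  shows "cevian_trace A B C (bpt x y z) = bpt 0 y z"
    and "cevian_trace B C A (bpt x y z) = bpt x 0 z"
    and "cevian_trace C A B (bpt x y z) = bpt x y 0"
proof -
  interpret rot: triangle B C A by (rule rotate)
  interpret rot2: triangle C A B by (rule rot.rotate)
  show "cevian_trace A B C (bpt x y z) = bpt 0 y z"
    "cevian_trace B C A (bpt x y z) = bpt x 0 z"
    "cevian_trace C A B (bpt x y z) = bpt x y 0"
    using assms cevian_trace_bpt[of y z x] rot.cevian_trace_bpt[of z x y] rot2.cevian_trace_bpt[of x y z]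
    by (simp_all add: bpt_rotate rot.bpt_rotate)
qed

lemma bpt_in_sides:
  assumes "(x, y, z) \<noteq> 0"
  shows "bpt x y z \<in> sides A B C \<longleftrightarrow> x = 0 \<or> y = 0 \<or> z = 0"
proof -
  have "join (Pt B) (Pt C) = bline 1 0 0" "join (Pt C) (Pt A) = bline 0 1 0"
    "join (Pt A) (Pt B) = bline 0 0 1"
    unfolding Pt_vertices by (subst join_eq_bline; simp add: zero_prod_def)+
  with assms show ?thesis by (simp add: sides_def bpt_in_bline)
qed

lemma inv_complement: "inv (complement A B C) = (\<lambda>p. A + B + C - 2 *\<^sub>R p)"
proof (rule inv_equality)
  show "A + B + C - 2 *\<^sub>R complement A B C p = p" for p
    by (simp add: complement_def centroid_def vec_eq_iff field_simps)
  show "complement A B C (A + B + C - 2 *\<^sub>R p) = p" for p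
    by (simp add: complement_def centroid_def vec_eq_iff field_simps)
qed

lemma bpt_in_anticompl_sides:
  assumes "(x, y, z) \<noteq> 0"
  shows "bpt x y z \<in> anticompl_sides A B C \<longleftrightarrow> y + z = 0 \<or> z + x = 0 \<or> x + y = 0"
proof -
  have v: "Pt (A + B + C - 2 *\<^sub>R A) = bpt (-1) 1 1" "Pt (A + B + C - 2 *\<^sub>R B) = bpt 1 (-1) 1"
    "Pt (A + B + C - 2 *\<^sub>R C) = bpt 1 1 (-1)"
    using Pt_eq_bpt[of "-1" 1 1] Pt_eq_bpt[of 1 "-1" 1] Pt_eq_bpt[of 1 1 "-1"]
    by (simp_all add: algebra_simps scaleR_2)
  have "join (bpt 1 (-1) 1) (bpt 1 1 (-1)) = bline 0 2 2"
    "join (bpt 1 1 (-1)) (bpt (-1) 1 1) = bline 2 0 2"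
    "join (bpt (-1) 1 1) (bpt 1 (-1) 1) = bline 2 2 0"
    by (subst join_eq_bline; simp add: zero_prod_def)+
  with assms show ?thesis
    by (auto simp: anticompl_sides_def sides_def inv_complement Let_def v bpt_in_bline)
qed

text \<open>
  The cross product of \<open>(l, m, n)\<close> with the line at infinity \<open>(1, 1, 1)\<close> gives the direction of the line.
\<close>

lemma parallel_through_bline:
  assumes "(m - n, n - l, l - m) \<noteq> 0"
  shows "parallel_through p (bline l m n) = join (Pt p) (bpt (m - n) (n - l) (l - m))"
  using assms unfolding parallel_through_def l_inf_eq_bline
  by (simp add: meet_bline)

section \<open>Affine reflections\<close>

text \<open>
  A linear equation of a line on the level of the ambient vector space, for use where a
  point is not given by its barycentric coordinates.
\<close>

lemma bline_functional:
  obtains \<phi> :: "(real^2) \<times> real \<Rightarrow> real"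
  where "linear \<phi>" "\<And>x y z. \<phi> (lift (x, y, z)) = l * x + m * y + n * z"
    "\<And>u. u \<noteq> 0 \<Longrightarrow> hpoint u \<in> bline l m n \<longleftrightarrow> \<phi> u = 0"
proof -
  obtain g where g: "linear g" "g \<circ> lift = id"
    using linear_injective_left_inverse[OF linear_lift inj_lift] by blast
  have gl: "g (lift v) = v" for v using g(2) by (metis comp_apply id_apply)
  define \<psi> :: "real \<times> real \<times> real \<Rightarrow> real" where "\<psi> = (\<lambda>(x, y, z). l * x + m * y + n * z)"
  have "linear \<psi>" unfolding \<psi>_def by (rule linearI) (auto simp: algebra_simps)
  then have 1: "linear (\<psi> \<circ> g)" using g(1) linear_compose by blast
  have 2: "(\<psi> \<circ> g) (lift (x, y, z)) = l * x + m * y + n * z" for x y z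
    by (simp add: gl \<psi>_def)
  have "hpoint u \<in> bline l m n \<longleftrightarrow> (\<psi> \<circ> g) u = 0" if "u \<noteq> 0" for u
  proof -
    obtain v where v: "lift v = u" using surj_lift by (metis surjD)
    obtain x y z where xyz: "v = (x, y, z)" by (cases v)
    have nz: "(x, y, z) \<noteq> 0" using that v xyz lift_eq_0_iff by blast
    show ?thesis unfolding v[symmetric] xyz 2 bpt_def[symmetric] by (rule bpt_in_bline[OF nz])
  qed
  with 1 2 that show thesis by blast
qed

text \<open>
  In homogeneous coordinates the reflection about \<open>l\<close> in the direction \<open>d\<close> is the usual
  linear reflection \<open>X \<mapsto> X - 2 (l \<bullet> X) / (l \<bullet> d) d\<close>. It is defined on ordinary points as
  \<open>h\<close>; that map is affine because \<open>l\<close> has a linear equation, and its values at the vertices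
  give the formula for all points, including the infinite ones.
\<close>

lemma extend_affine_reflection:
  fixes l\<^sub>1 l\<^sub>2 l\<^sub>3 m\<^sub>1 m\<^sub>2 m\<^sub>3 d\<^sub>1 d\<^sub>2 d\<^sub>3 :: real
  defines "d\<^sub>1 \<equiv> m\<^sub>2 - m\<^sub>3" and "d\<^sub>2 \<equiv> m\<^sub>3 - m\<^sub>1" and "d\<^sub>3 \<equiv> m\<^sub>1 - m\<^sub>2"
  defines "\<delta> \<equiv> l\<^sub>1 * d\<^sub>1 + l\<^sub>2 * d\<^sub>2 + l\<^sub>3 * d\<^sub>3"
  assumes "\<delta> \<noteq> 0" and nz: "(x, y, z) \<noteq> 0"
    and k: "k = 2 * (l\<^sub>1 * x + l\<^sub>2 * y + l\<^sub>3 * z) / \<delta>"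
  shows "extend (affine_reflection (bline l\<^sub>1 l\<^sub>2 l\<^sub>3) (bline m\<^sub>1 m\<^sub>2 m\<^sub>3)) (bpt x y z) =
    bpt (x - k * d\<^sub>1) (y - k * d\<^sub>2) (z - k * d\<^sub>3)"
proof -
  obtain \<phi> where \<phi>: "linear \<phi>" "\<And>x y z. \<phi> (lift (x, y, z)) = l\<^sub>1 * x + l\<^sub>2 * y + l\<^sub>3 * z"
    and on_line: "\<And>u. u \<noteq> 0 \<Longrightarrow> hpoint u \<in> bline l\<^sub>1 l\<^sub>2 l\<^sub>3 \<longleftrightarrow> \<phi> u = 0"
    using bline_functional[of l\<^sub>1 l\<^sub>2 l\<^sub>3] by blast
  define v where "v = d\<^sub>1 *\<^sub>R A + d\<^sub>2 *\<^sub>R B + d\<^sub>3 *\<^sub>R C"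
  have lift_d: "lift (d\<^sub>1, d\<^sub>2, d\<^sub>3) = (v, 0)"
    by (simp add: lift_def v_def d\<^sub>1_def d\<^sub>2_def d\<^sub>3_def)
  have \<phi>v: "\<phi> (v, 0) = \<delta>" using \<phi>(2)[of d\<^sub>1 d\<^sub>2 d\<^sub>3] by (simp add: lift_d \<delta>_def)
  have d: "(d\<^sub>1, d\<^sub>2, d\<^sub>3) \<noteq> 0" using \<open>\<delta> \<noteq> 0\<close> by (auto simp: \<delta>_def zero_prod_def)
  then have v0: "(v, 0::real) \<noteq> 0" using lift_d lift_eq_0_iff by metis
  define h where "h = (\<lambda>p. p - (2 * \<phi> (p, 1) / \<delta>) *\<^sub>R v)"
  have h: "affine_reflection (bline l\<^sub>1 l\<^sub>2 l\<^sub>3) (bline m\<^sub>1 m\<^sub>2 m\<^sub>3) p = h p" for p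
  proof -
    have par: "Pt p' \<in> parallel_through p (bline m\<^sub>1 m\<^sub>2 m\<^sub>3) \<longleftrightarrow> (\<exists>t. p' = p + t *\<^sub>R v)" for p'
    proof -
      have "parallel_through p (bline m\<^sub>1 m\<^sub>2 m\<^sub>3) = join (hpoint (p, 1)) (hpoint (v, 0))"
        using d unfolding d\<^sub>1_def d\<^sub>2_def d\<^sub>3_def
        by (simp add: parallel_through_bline)
           (simp add: Pt_hpoint bpt_def lift_d[unfolded d\<^sub>1_def d\<^sub>2_def d\<^sub>3_def])
      then have "Pt p' \<in> parallel_through p (bline m\<^sub>1 m\<^sub>2 m\<^sub>3) \<longleftrightarrow>
          (\<exists>s t. (p', 1) = s *\<^sub>R (p, 1::real) + t *\<^sub>R (v, 0))"
        unfolding Pt_hpoint using v0 by (simp only: mem_join_hpoint) (simp add: mem_join_hpoint zero_prod_def)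
      then show ?thesis by auto
    qed
    have mid: "Pt (midpoint p (p + t *\<^sub>R v)) \<in> bline l\<^sub>1 l\<^sub>2 l\<^sub>3 \<longleftrightarrow> t = - 2 * \<phi> (p, 1) / \<delta>" for t
    proof -
      have "(midpoint p (p + t *\<^sub>R v), 1) = (p, 1::real) + (t / 2) *\<^sub>R (v, 0)"
        by (simp add: midpoint_def vec_eq_iff field_simps)
      then have "\<phi> (midpoint p (p + t *\<^sub>R v), 1) = \<phi> (p, 1) + (t / 2) * \<delta>"
        by (simp only: linear_add[OF \<phi>(1)] linear_scale[OF \<phi>(1)] \<phi>v real_scaleR_def)
      then have "Pt (midpoint p (p + t *\<^sub>R v)) \<in> bline l\<^sub>1 l\<^sub>2 l\<^sub>3 \<longleftrightarrow> \<phi> (p, 1) + (t / 2) * \<delta> = 0"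
        unfolding Pt_hpoint by (subst on_line) (simp_all add: zero_prod_def)
      also have "\<dots> \<longleftrightarrow> t = - 2 * \<phi> (p, 1) / \<delta>" using \<open>\<delta> \<noteq> 0\<close> by (auto simp: field_simps)
      finally show ?thesis .
    qed
    show ?thesis
      unfolding affine_reflection_def
    proof (rule the_equality)
      have "h p = p + (- 2 * \<phi> (p, 1) / \<delta>) *\<^sub>R v" by (simp add: h_def)
      then show "Pt (h p) \<in> parallel_through p (bline m\<^sub>1 m\<^sub>2 m\<^sub>3) \<and> Pt (midpoint p (h p)) \<in> bline l\<^sub>1 l\<^sub>2 l\<^sub>3"
        using par mid by metis
    next
      fix p'
      assume *: "Pt p' \<in> parallel_through p (bline m\<^sub>1 m\<^sub>2 m\<^sub>3) \<and> Pt (midpoint p p') \<in> bline l\<^sub>1 l\<^sub>2 l\<^sub>3"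
      then obtain t where t: "p' = p + t *\<^sub>R v" using par by blast
      with * mid have "t = - 2 * \<phi> (p, 1) / \<delta>" by blast
      with t show "p' = h p" by (simp add: h_def)
    qed
  qed
  have split: "\<phi> (p, 1) = \<phi> (p, 0) + \<phi> (0, 1)" for p
    using linear_add[OF \<phi>(1), of "(p, 0)" "(0, 1)"] by simp
  have add0: "\<phi> (p + q, 0) = \<phi> (p, 0) + \<phi> (q, 0)" for p q
    using linear_add[OF \<phi>(1), of "(p, 0)" "(q, 0)"] by simp
  have scale0: "\<phi> (c *\<^sub>R p, 0) = c * \<phi> (p, 0)" for c p
    using linear_scale[OF \<phi>(1), of c "(p, 0)"] by simp
  have "affine_map h"
    unfolding affine_map_def
  proof (intro exI conjI allI)
    show "linear (\<lambda>p. p - (2 * \<phi> (p, 0) / \<delta>) *\<^sub>R v)"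
      by (rule linearI) (simp_all add: add0 scale0 algebra_simps add_divide_distrib)
    show "h p = p - (2 * \<phi> (p, 0) / \<delta>) *\<^sub>R v + - (2 * \<phi> (0, 1) / \<delta>) *\<^sub>R v" for p
      by (simp add: h_def split[of p] algebra_simps add_divide_distrib)
  qed
  have "\<phi> (A, 1) = l\<^sub>1" "\<phi> (B, 1) = l\<^sub>2" "\<phi> (C, 1) = l\<^sub>3"
    using \<phi>(2)[of 1 0 0] \<phi>(2)[of 0 1 0] \<phi>(2)[of 0 0 1] by (simp_all add: lift_def)
  then have hv: "h A = A - (2 * l\<^sub>1 / \<delta>) *\<^sub>R v" "h B = B - (2 * l\<^sub>2 / \<delta>) *\<^sub>R v"
    "h C = C - (2 * l\<^sub>3 / \<delta>) *\<^sub>R v" by (simp_all add: h_def)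
  have "k = x * (2 * l\<^sub>1 / \<delta>) + y * (2 * l\<^sub>2 / \<delta>) + z * (2 * l\<^sub>3 / \<delta>)"
    by (simp add: k add_divide_distrib algebra_simps)
  then have "x *\<^sub>R h A + y *\<^sub>R h B + z *\<^sub>R h C = x *\<^sub>R A + y *\<^sub>R B + z *\<^sub>R C - k *\<^sub>R v"
    unfolding hv by (simp add: algebra_simps)
  then have "(x *\<^sub>R h A + y *\<^sub>R h B + z *\<^sub>R h C, x + y + z) =
      lift (x - k * d\<^sub>1, y - k * d\<^sub>2, z - k * d\<^sub>3)"
    by (simp add: lift_def v_def d\<^sub>1_def d\<^sub>2_def d\<^sub>3_def algebra_simps)
  moreover have "affine_reflection (bline l\<^sub>1 l\<^sub>2 l\<^sub>3) (bline m\<^sub>1 m\<^sub>2 m\<^sub>3) = h" using h by blast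
  ultimately show ?thesis
    using extend_affine[OF \<open>affine_map h\<close> nz] by (simp add: bpt_def)
qed

text \<open>
  Modulo \<open>A\<close>, the line \<open>A Q\<close> is the direction \<open>(b, c)\<close> and the line \<open>E F\<close> has the direction \<open>(b, -c)\<close>.
  The reflection fixes the former and negates the latter, so it sends \<open>(y, z)\<close> to
  \<open>(b z / c, c y / b)\<close>, whose ratio is \<open>b\<^sup>2 z : c\<^sup>2 y\<close>.
\<close>

lemma join_vertex_reflection:
  assumes "p \<noteq> 0" "q \<noteq> 0" "r \<noteq> 0" "r + p \<noteq> 0" "p + q \<noteq> 0" "y \<noteq> 0 \<or> z \<noteq> 0"
  defines "b \<equiv> q * (r + p)" and "c \<equiv> r * (p + q)"
  shows "join (Pt A) (extend (affine_reflection (join (Pt A) (bpt a b c))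
            (join (bpt p 0 r) (bpt p q 0))) (bpt x y z)) = bline 0 (- (c\<^sup>2 * y)) (b\<^sup>2 * z)"
proof -
  have bc: "b \<noteq> 0" "c \<noteq> 0" using assms by (simp_all add: b_def c_def)
  have nz: "(x, y, z) \<noteq> 0" using assms(6) by (auto simp: zero_prod_def)
  define k where "k = (c * y - b * z) / (b * c)"
  have l: "join (Pt A) (bpt a b c) = bline 0 (- c) b"
    using bc by (simp add: join_vertex)
  have m: "join (bpt p 0 r) (bpt p q 0) = bline (- (r * q)) (r * p) (p * q)"
    using assms by (subst join_eq_bline) (simp_all add: zero_prod_def)
  have d2: "p * q - - (r * q) = b" by (simp add: b_def algebra_simps)
  have d3: "- (r * q) - r * p = - c" by (simp add: c_def algebra_simps)
  have \<delta>: "0 * (r * p - p * q) + - c * b + b * - c = - 2 * (b * c)" by simp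
  have k2: "k = 2 * (0 * x + - c * y + b * z) / (- 2 * (b * c))"
    using bc by (simp add: k_def field_simps)
  have "extend (affine_reflection (join (Pt A) (bpt a b c))
            (join (bpt p 0 r) (bpt p q 0))) (bpt x y z) =
        bpt (x - k * (r * p - p * q)) (y - k * b) (z - k * - c)"
    unfolding l m
    using extend_affine_reflection[of 0 "r * p" "p * q" "- c" "- (r * q)" b x y z k,
        unfolded d2 d3 \<delta>, OF _ nz k2] bc by simp
  also have "y - k * b = b * z / c" using bc by (simp add: k_def field_simps)
  also have "z - k * - c = c * y / b" using bc by (simp add: k_def field_simps)
  finally have "join (Pt A) (extend (affine_reflection (join (Pt A) (bpt a b c))
            (join (bpt p 0 r) (bpt p q 0))) (bpt x y z)) = bline 0 (- (c * y / b)) (b * z / c)"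
    using bc assms(6) by (subst join_vertex[symmetric]) auto
  also have "\<dots> = bline (b * c * 0) (b * c * (- (c * y / b))) (b * c * (b * z / c))"
    using bc by (subst bline_scale) simp_all
  also have "\<dots> = bline 0 (- (c\<^sup>2 * y)) (b\<^sup>2 * z)"
    using bc by (simp add: power2_eq_square mult.assoc)
  finally show ?thesis .
qed

section \<open>The cevian map\<close>

lemma affine_map_eqI:
  assumes "affine_map f" "affine_map g" "f A = g A" "f B = g B" "f C = g C"
  shows "f = g"
proof
  fix p
  obtain v where v: "lift v = (p, 1)" using surj_lift by (metis surjD)
  obtain x y z where xyz: "v = (x, y, z)" by (cases v)
  have p: "p = x *\<^sub>R A + y *\<^sub>R B + z *\<^sub>R C" and s: "x + y + z = 1"
    using v xyz by (simp_all add: lift_def)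
  have at_p: "f' p = x *\<^sub>R f' A + y *\<^sub>R f' B + z *\<^sub>R f' C" if f': "affine_map f'" for f'
  proof -
    obtain L b where L: "linear L" and f: "\<And>p. f' p = L p + b"
      using f' by (auto simp: affine_map_def)
    have "(x + y + z) *\<^sub>R b = b" using s by simp
    then show ?thesis
      by (simp add: p f linear_add[OF L] linear_scale[OF L] algebra_simps)
  qed
  show "f p = g p" using at_p[OF assms(1)] at_p[OF assms(2)] assms(3-5) by simp
qed

lemma affine_map_exists:
  obtains f where "affine_map f" "f A = a" "f B = b" "f C = c"
proof -
  obtain g where g: "linear g" "g \<circ> lift = id"
    using linear_injective_left_inverse[OF linear_lift inj_lift] by blast
  have gl: "g (lift v) = v" for v using g(2) by (metis comp_apply id_apply)
  define \<psi> :: "real \<times> real \<times> real \<Rightarrow> real^2"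
    where "\<psi> = (\<lambda>(x, y, z). x *\<^sub>R a + y *\<^sub>R b + z *\<^sub>R c)"
  have "linear \<psi>" unfolding \<psi>_def by (rule linearI) (auto simp: algebra_simps)
  moreover have "linear (\<lambda>p :: real^2. (p, 0::real))" by (rule linearI) auto
  ultimately have "linear (\<lambda>p. \<psi> (g (p, 0)))"
    using g(1) linear_compose[of "\<lambda>p. (p, 0::real)" g] linear_compose[of "g \<circ> (\<lambda>p. (p, 0::real))" \<psi>]
    by (simp add: o_def)
  moreover have "\<psi> (g (p, 1)) = \<psi> (g (p, 0)) + \<psi> (g (0, 1))" for p
    using linear_add[OF \<open>linear \<psi>\<close>] linear_add[OF g(1), of "(p, 0)" "(0, 1)"] by simp
  ultimately have "affine_map (\<lambda>p. \<psi> (g (p, 1)))" unfolding affine_map_def by blast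
  moreover have "g (A, 1) = (1, 0, 0)" "g (B, 1) = (0, 1, 0)" "g (C, 1) = (0, 0, 1)"
    using gl[of "(1, 0, 0)"] gl[of "(0, 1, 0)"] gl[of "(0, 0, 1)"] by (simp_all add: lift_def)
  ultimately show thesis using that[of "\<lambda>p. \<psi> (g (p, 1))"] by (simp add: \<psi>_def)
qed

lemma cevian_map_bpt:
  assumes "u \<noteq> 0" "v \<noteq> 0" "w \<noteq> 0" "v + w \<noteq> 0" "w + u \<noteq> 0" "u + v \<noteq> 0"
  shows "affine_map (cevian_map A B C (bpt u v w))"
    and "cevian_map A B C (bpt u v w) A = (v / (v + w)) *\<^sub>R B + (w / (v + w)) *\<^sub>R C"
    and "cevian_map A B C (bpt u v w) B = (u / (w + u)) *\<^sub>R A + (w / (w + u)) *\<^sub>R C"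
    and "cevian_map A B C (bpt u v w) C = (u / (u + v)) *\<^sub>R A + (v / (u + v)) *\<^sub>R B"
proof -
  define a where "a = (v / (v + w)) *\<^sub>R B + (w / (v + w)) *\<^sub>R C"
  define b where "b = (u / (w + u)) *\<^sub>R A + (w / (w + u)) *\<^sub>R C"
  define c where "c = (u / (u + v)) *\<^sub>R A + (v / (u + v)) *\<^sub>R B"
  have "Pt a = bpt 0 (v / (v + w)) (w / (v + w))"
    using assms Pt_eq_bpt[of 0 "v / (v + w)" "w / (v + w)"]
    by (simp add: a_def add_divide_distrib[symmetric])
  also have "\<dots> = bpt 0 v w"
    using assms bpt_scale[of "1 / (v + w)" 0 v w] by simp
  finally have a: "cevian_trace A B C (bpt u v w) = Pt a" using assms by (simp add: cevian_traces_bpt)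
  have "Pt b = bpt (u / (w + u)) 0 (w / (w + u))"
    using assms Pt_eq_bpt[of "u / (w + u)" 0 "w / (w + u)"]
    by (simp add: b_def add_divide_distrib[symmetric] add.commute)
  also have "\<dots> = bpt u 0 w"
    using assms bpt_scale[of "1 / (w + u)" u 0 w] by simp
  finally have b: "cevian_trace B C A (bpt u v w) = Pt b" using assms by (simp add: cevian_traces_bpt)
  have "Pt c = bpt (u / (u + v)) (v / (u + v)) 0"
    using assms Pt_eq_bpt[of "u / (u + v)" "v / (u + v)" 0]
    by (simp add: c_def add_divide_distrib[symmetric])
  also have "\<dots> = bpt u v 0"
    using assms bpt_scale[of "1 / (u + v)" u v 0] by simp
  finally have c: "cevian_trace C A B (bpt u v w) = Pt c" using assms by (simp add: cevian_traces_bpt)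
  obtain f where f: "affine_map f" "f A = a" "f B = b" "f C = c" by (rule affine_map_exists)
  have "cevian_map A B C (bpt u v w) = f"
    unfolding cevian_map_def a b c Pt_inject
    by (rule the_equality) (use f in \<open>auto intro: affine_map_eqI\<close>)
  with f show "affine_map (cevian_map A B C (bpt u v w))"
    "cevian_map A B C (bpt u v w) A = (v / (v + w)) *\<^sub>R B + (w / (v + w)) *\<^sub>R C"
    "cevian_map A B C (bpt u v w) B = (u / (w + u)) *\<^sub>R A + (w / (w + u)) *\<^sub>R C"
    "cevian_map A B C (bpt u v w) C = (u / (u + v)) *\<^sub>R A + (v / (u + v)) *\<^sub>R B"
    by (simp_all add: a_def b_def c_def)
qed

text \<open>
  The trace of \<open>X\<close> on \<open>B C\<close> is \<open>(0 : y : z)\<close>, and the affine map sends it to \<open>y T(B) + z T(C)\<close>, with the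
  vertices \<open>T(B)\<close>, \<open>T(C)\<close> of the cevian triangle normalised to coordinate sum 1. Of these only
  \<open>T(C)\<close> has a component at \<open>B\<close> and only \<open>T(B)\<close> has one at \<open>C\<close>, which swaps \<open>y\<close> and \<open>z\<close>.
\<close>

lemma join_vertex_cevian_map:
  assumes "u \<noteq> 0" "v \<noteq> 0" "w \<noteq> 0" "v + w \<noteq> 0" "w + u \<noteq> 0" "u + v \<noteq> 0" "y \<noteq> 0 \<or> z \<noteq> 0"
  shows "join (Pt A) (extend (cevian_map A B C (bpt u v w)) (cevian_trace A B C (bpt x y z))) =
           bline 0 (- (w * (u + v) * y)) (v * (w + u) * z)"
proof -
  let ?T = "cevian_map A B C (bpt u v w)"
  note T = cevian_map_bpt[OF assms(1-6)]
  have nz: "(0, y, z) \<noteq> 0" using assms(7) by (auto simp: zero_prod_def)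
  have "y * u / (w + u) + y * w / (w + u) = y" "z * u / (u + v) + z * v / (u + v) = z"
    unfolding add_divide_distrib[symmetric] distrib_left[symmetric] add.commute[of u w]
    using assms(5,6) by simp_all
  then have "y + z = y * u / (w + u) + z * u / (u + v) + z * v / (u + v) + y * w / (w + u)"
    by linarith
  then have "(0 *\<^sub>R ?T A + y *\<^sub>R ?T B + z *\<^sub>R ?T C, 0 + y + z) =
      lift (y * u / (w + u) + z * u / (u + v), z * v / (u + v), y * w / (w + u))"
    unfolding T lift_def by (simp add: algebra_simps)
  then have "extend ?T (bpt 0 y z) =
      bpt (y * u / (w + u) + z * u / (u + v)) (z * v / (u + v)) (y * w / (w + u))"
    by (simp only: extend_affine[OF T(1) nz] bpt_def[symmetric])
  then have "join (Pt A) (extend (cevian_map A B C (bpt u v w)) (cevian_trace A B C (bpt x y z))) =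
      bline 0 (- (y * w / (w + u))) (z * v / (u + v))"
    using assms by (subst join_vertex[symmetric]) (auto simp: cevian_trace_bpt)
  also have "\<dots> = bline ((w + u) * (u + v) * 0) ((w + u) * (u + v) * (- (y * w / (w + u))))
      ((w + u) * (u + v) * (z * v / (u + v)))"
    using assms by (subst bline_scale) simp_all
  also have "\<dots> = bline 0 (- (w * (u + v) * y)) (v * (w + u) * z)"
    using assms by (simp add: mult_ac)
  finally show ?thesis .
qed

end

section \<open>The generalized orthocenter\<close>

text \<open>
  The conditions say that \<open>(p : q : r)\<close> lies neither on a side of the triangle nor on a side of the
  anticomplementary triangle.
\<close>

locale triangle_point = triangle +
  fixes p q r :: real
  assumes nz: "p \<noteq> 0" "q \<noteq> 0" "r \<noteq> 0"
    and sums: "q + r \<noteq> 0" "r + p \<noteq> 0" "p + q \<noteq> 0"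
begin

definition \<sigma> :: real where "\<sigma> = p * q + q * r + r * p"

lemma rotate_point: "triangle_point B C A q r p"
  using nondegenerate nz sums by unfold_locales (simp_all add: insert_commute add.commute)

lemma sigma_rotate: "triangle_point.\<sigma> q r p = \<sigma>"
  using triangle_point.\<sigma>_def[OF rotate_point] by (simp add: \<sigma>_def)

text \<open>
  This is what prevents the altitudes through \<open>A\<close> from degenerating, and any two altitudes
  from coinciding: if both differences vanished, then \<open>q\<^sup>2 = r\<^sup>2\<close>, so \<open>q = r\<close> as \<open>q + r \<noteq> 0\<close>, and
  \<open>\<sigma> = q\<^sup>2 + 2 p q\<close> would force \<open>p q = 0\<close>.
\<close>

lemma not_both_squares: "q\<^sup>2 - \<sigma> \<noteq> 0 \<or> r\<^sup>2 - \<sigma> \<noteq> 0"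
proof (rule ccontr)
  assume "\<not> ?thesis"
  then have e: "q\<^sup>2 = \<sigma>" "r\<^sup>2 = \<sigma>" by auto
  have "(q + r) * (q - r) = 0" using e by (simp add: algebra_simps power2_eq_square)
  then have "q = r" using sums by simp
  moreover have "r\<^sup>2 = p * q + q * r + r * p" using e(2) by (simp add: \<sigma>_def)
  ultimately have "2 * (p * r) = 0" by (simp add: power2_eq_square)
  with nz show False by simp
qed

text \<open>
  The direction of \<open>Q D\<close> has its last two coordinates in the ratio \<open>q (r\<^sup>2 - \<sigma>) : r (q\<^sup>2 - \<sigma>)\<close>. Dividing
  by \<open>(q\<^sup>2 - \<sigma>) (r\<^sup>2 - \<sigma>)\<close> suggests the point \<open>(p / (p\<^sup>2 - \<sigma>) : q / (q\<^sup>2 - \<sigma>) : r / (r\<^sup>2 - \<sigma>))\<close> as the intersection of the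
  altitudes.
\<close>

lemma altitude:
  "parallel_through A (join (bpt (p * (q + r)) (q * (r + p)) (r * (p + q))) (bpt 0 q r)) =
     bline 0 (r * (q\<^sup>2 - \<sigma>)) (- (q * (r\<^sup>2 - \<sigma>)))"
proof -
  define a b c where abc: "a = p * (q + r)" "b = q * (r + p)" "c = r * (p + q)"
  have a: "a \<noteq> 0" using nz sums by (simp add: abc)
  have QD: "join (bpt a b c) (bpt 0 q r) = bline (b * r - c * q) (- (a * r)) (a * q)"
    using a nz by (subst join_eq_bline) (simp_all add: zero_prod_def)
  have d: "a * q - (b * r - c * q) = q * (\<sigma> - r\<^sup>2)" "b * r - c * q - - (a * r) = r * (\<sigma> - q\<^sup>2)"
    by (simp_all add: abc \<sigma>_def algebra_simps power2_eq_square)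
  have yz: "q * (\<sigma> - r\<^sup>2) \<noteq> 0 \<or> r * (\<sigma> - q\<^sup>2) \<noteq> 0" using not_both_squares nz by auto
  have "parallel_through A (bline (b * r - c * q) (- (a * r)) (a * q)) =
      join (Pt A) (bpt (- (a * r) - a * q) (q * (\<sigma> - r\<^sup>2)) (r * (\<sigma> - q\<^sup>2)))"
    using yz by (subst parallel_through_bline; unfold d) (auto simp: zero_prod_def)
  also have "\<dots> = bline 0 (- (r * (\<sigma> - q\<^sup>2))) (q * (\<sigma> - r\<^sup>2))"
    by (rule join_vertex) (rule yz)
  finally show ?thesis unfolding QD[unfolded abc] abc by (simp add: algebra_simps)
qed

text \<open>
  The point \<open>(p / (p\<^sup>2 - \<sigma>) : q / (q\<^sup>2 - \<sigma>) : r / (r\<^sup>2 - \<sigma>))\<close> with denominators cleared. In this form it is also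
  correct when one of the differences is zero, in which case it is a vertex.
\<close>

abbreviation ortho :: xpoint where
  "ortho \<equiv> bpt (p * (q\<^sup>2 - \<sigma>) * (r\<^sup>2 - \<sigma>)) (q * (r\<^sup>2 - \<sigma>) * (p\<^sup>2 - \<sigma>)) (r * (p\<^sup>2 - \<sigma>) * (q\<^sup>2 - \<sigma>))"

text \<open>
  The altitudes through \<open>A\<close> and \<open>B\<close> are different lines, since at most one of \<open>p\<^sup>2 - \<sigma>\<close>, \<open>q\<^sup>2 - \<sigma>\<close>, \<open>r\<^sup>2 - \<sigma>\<close>
  vanishes. So they have exactly one common point, and it satisfies the equation of the altitude
  through \<open>C\<close>.
\<close>

lemma gen_orthocenter_bpt: "gen_orthocenter A B C (bpt p q r) = ortho"
proof -
  interpret r1: triangle_point B C A q r p by (rule rotate_point)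
  interpret r2: triangle_point C A B r p q by (rule r1.rotate_point)
  have s: "r1.\<sigma> = \<sigma>" "r2.\<sigma> = \<sigma>" using sigma_rotate r1.sigma_rotate by simp_all
  define \<alpha> \<beta> \<gamma> where abc: "\<alpha> = p\<^sup>2 - \<sigma>" "\<beta> = q\<^sup>2 - \<sigma>" "\<gamma> = r\<^sup>2 - \<sigma>"
  have nv: "\<beta> \<noteq> 0 \<or> \<gamma> \<noteq> 0" "\<gamma> \<noteq> 0 \<or> \<alpha> \<noteq> 0" "\<alpha> \<noteq> 0 \<or> \<beta> \<noteq> 0"
    using not_both_squares r1.not_both_squares r2.not_both_squares by (simp_all add: s abc)
  let ?Q = "bpt (p * (q + r)) (q * (r + p)) (r * (p + q))"
  have A: "parallel_through A (join ?Q (bpt 0 q r)) = bline 0 (r * \<beta>) (- (q * \<gamma>))"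
    unfolding abc by (rule altitude)
  have B: "parallel_through B (join ?Q (bpt p 0 r)) = bline (- (r * \<alpha>)) 0 (p * \<gamma>)"
    using r1.altitude by (simp only: bpt_rotate bline_rotate s abc)
  have C: "parallel_through C (join ?Q (bpt p q 0)) = bline (q * \<alpha>) (- (p * \<beta>)) 0"
    using r2.altitude by (simp only: r1.bpt_rotate r1.bline_rotate bpt_rotate bline_rotate s abc)
  let ?H = "bpt (p * \<beta> * \<gamma>) (q * \<gamma> * \<alpha>) (r * \<alpha> * \<beta>)"
  have Hnz: "(p * \<beta> * \<gamma>, q * \<gamma> * \<alpha>, r * \<alpha> * \<beta>) \<noteq> 0" using nv nz by (auto simp: zero_prod_def)
  have AB: "X \<in> bline 0 (r * \<beta>) (- (q * \<gamma>)) \<and> X \<in> bline (- (r * \<alpha>)) 0 (p * \<gamma>) \<longleftrightarrow> X = ?H" for X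
  proof -
    have cross: "r * \<beta> * (p * \<gamma>) - - (q * \<gamma>) * 0 = r * (p * \<beta> * \<gamma>)"
      "- (q * \<gamma>) * - (r * \<alpha>) - 0 * (p * \<gamma>) = r * (q * \<gamma> * \<alpha>)"
      "0 * 0 - r * \<beta> * - (r * \<alpha>) = r * (r * \<alpha> * \<beta>)"
      by simp_all
    have "(r * (p * \<beta> * \<gamma>), r * (q * \<gamma> * \<alpha>), r * (r * \<alpha> * \<beta>)) \<noteq> 0"
      using Hnz nz(3) by (simp add: zero_prod_def)
    then show ?thesis
      using blines_meet[of "r * \<beta>" "p * \<gamma>" "- (q * \<gamma>)" 0 "- (r * \<alpha>)" 0 X]
      unfolding cross bpt_scale[OF nz(3)] by blast
  qed
  have HC: "?H \<in> bline (q * \<alpha>) (- (p * \<beta>)) 0"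
    unfolding bpt_in_bline[OF Hnz] by (simp add: mult_ac)
  show ?thesis
    unfolding gen_orthocenter_def Let_def isotomcomplement_bpt[OF nz] cevian_traces_bpt[OF nz] A B C
      abc[symmetric]
  proof (rule the_equality)
    show "?H \<in> bline 0 (r * \<beta>) (- (q * \<gamma>)) \<and> ?H \<in> bline (- (r * \<alpha>)) 0 (p * \<gamma>) \<and>
        ?H \<in> bline (q * \<alpha>) (- (p * \<beta>)) 0" using AB HC by blast
  qed (use AB in blast)
qed

lemma ortho_is_vertex:
  assumes "p\<^sup>2 = \<sigma>" shows "ortho = Pt A"
proof -
  have "q\<^sup>2 - \<sigma> \<noteq> 0" "r\<^sup>2 - \<sigma> \<noteq> 0"
    using triangle_point.not_both_squares[OF rotate_point] assms
      triangle_point.not_both_squares[OF triangle_point.rotate_point[OF rotate_point]]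
      triangle_point.sigma_rotate[OF rotate_point] sigma_rotate by auto
  then show ?thesis unfolding Pt_vertices
    using bpt_scale[of "p * (q\<^sup>2 - \<sigma>) * (r\<^sup>2 - \<sigma>)" 1 0 0] nz assms by simp
qed

section \<open>The generalized isogonal map as a cevian map\<close>

text \<open>
  Both lines pass through \<open>A\<close>, so only ratios have to be compared. The left-hand line has the ratio
  \<open>b\<^sup>2 z : c\<^sup>2 y\<close> with \<open>b = q (r + p)\<close>, \<open>c = r (p + q)\<close>; the right-hand one has
  \<open>v (w + u) z : w (u + v) y\<close>, where \<open>(u : v : w)\<close> is the orthocenter. The key factorization is
  \<open>v + w = - (p\<^sup>2 - \<sigma>) p (q + r)\<^sup>2\<close> with its cyclic variants: it shows that \<open>v (w + u)\<close> and \<open>w (u + v)\<close> are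
  \<open>b\<^sup>2\<close> and \<open>c\<^sup>2\<close> up to the common factor \<open>- (p\<^sup>2 - \<sigma>) (q\<^sup>2 - \<sigma>) (r\<^sup>2 - \<sigma>)\<close>. It also shows that none of the
  sums vanishes, so that the orthocenter has a cevian triangle of ordinary points.
\<close>

lemma cevian_lines_agree:
  assumes sq: "p\<^sup>2 - \<sigma> \<noteq> 0" "q\<^sup>2 - \<sigma> \<noteq> 0" "r\<^sup>2 - \<sigma> \<noteq> 0" and "bpt x y z \<noteq> Pt A" "(x, y, z) \<noteq> 0"
  shows "join (Pt A) (extend (affine_reflection
             (join (Pt A) (bpt (p * (q + r)) (q * (r + p)) (r * (p + q))))
             (join (bpt p 0 r) (bpt p q 0))) (bpt x y z)) =
         join (Pt A) (extend (cevian_map A B C ortho) (cevian_trace A B C (bpt x y z)))"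
proof -
  have yz: "y \<noteq> 0 \<or> z \<noteq> 0"
  proof (rule ccontr)
    assume "\<not> ?thesis"
    then have "y = 0" "z = 0" "x \<noteq> 0" using assms(5) by (auto simp: zero_prod_def)
    then have "bpt x y z = Pt A" using bpt_scale[of x 1 0 0] by (simp add: Pt_vertices)
    with assms(4) show False by simp
  qed
  define \<alpha> \<beta> \<gamma> where abc: "\<alpha> = p\<^sup>2 - \<sigma>" "\<beta> = q\<^sup>2 - \<sigma>" "\<gamma> = r\<^sup>2 - \<sigma>"
  define u v w where uvw: "u = p * \<beta> * \<gamma>" "v = q * \<gamma> * \<alpha>" "w = r * \<alpha> * \<beta>"
  have e: "v + w = - (\<alpha> * p * (q + r)\<^sup>2)" "w + u = - (\<beta> * q * (r + p)\<^sup>2)" "u + v = - (\<gamma> * r * (p + q)\<^sup>2)"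
    unfolding uvw abc \<sigma>_def by algebra+
  have nz': "u \<noteq> 0" "v \<noteq> 0" "w \<noteq> 0" "v + w \<noteq> 0" "w + u \<noteq> 0" "u + v \<noteq> 0"
    unfolding e using sq nz sums by (simp_all add: uvw abc)
  let ?k = "- (\<alpha> * \<beta> * \<gamma>)"
  have "?k \<noteq> 0" using sq by (simp add: abc)
  have "join (Pt A) (extend (cevian_map A B C (bpt u v w)) (cevian_trace A B C (bpt x y z)))
      = bline 0 (- (w * (u + v) * y)) (v * (w + u) * z)"
    by (rule join_vertex_cevian_map[OF nz' yz])
  also have "\<dots> = bline (?k * 0) (?k * (- ((r * (p + q))\<^sup>2 * y))) (?k * ((q * (r + p))\<^sup>2 * z))"
    unfolding e by (simp add: uvw power2_eq_square mult_ac)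
  also have "\<dots> = bline 0 (- ((r * (p + q))\<^sup>2 * y)) ((q * (r + p))\<^sup>2 * z)"
    by (rule bline_scale) fact
  finally show ?thesis
    unfolding uvw abc using join_vertex_reflection[OF nz sums(2,3) yz] by simp
qed

end

theorem theorem2p11:
  fixes A B C :: "real^2" and P :: xpoint
  assumes "\<not> collinear {A, B, C}"
    and "P \<notin> sides A B C"
    and "P \<notin> anticompl_sides A B C"
    and "gen_orthocenter A B C P \<notin> {Pt A, Pt B, Pt C}"
    and "P \<notin> isotomic A B C ` l_inf"
  shows "\<forall>X. X \<notin> {Pt A, Pt B, Pt C} \<longrightarrow>
           gen_isogonal A B C P X = delta A B C (gen_orthocenter A B C P) X"
proof (intro allI impI)
  fix X
  assume X: "X \<notin> {Pt A, Pt B, Pt C}"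
  interpret triangle A B C by unfold_locales fact
  obtain p q r where P: "(p, q, r) \<noteq> 0" "P = bpt p q r" by (rule bpt_cases)
  interpret triangle_point A B C p q r
    using assms(2,3) bpt_in_sides[OF P(1)] bpt_in_anticompl_sides[OF P(1)] P(2)
    by unfold_locales auto
  interpret r1: triangle_point B C A q r p by (rule rotate_point)
  interpret r2: triangle_point C A B r p q by (rule r1.rotate_point)
  have s: "r1.\<sigma> = \<sigma>" "r2.\<sigma> = \<sigma>" using sigma_rotate r1.sigma_rotate by simp_all
  have rot: "r1.bpt b c a = bpt a b c" "r2.bpt c a b = bpt a b c" for a b c
    using bpt_rotate r1.bpt_rotate by simp_all
  have o: "r1.ortho = ortho" "r2.ortho = ortho"
    unfolding s rot by (simp_all only: mult_ac)
  have vertex: "q\<^sup>2 = \<sigma> \<Longrightarrow> ortho = Pt B" "r\<^sup>2 = \<sigma> \<Longrightarrow> ortho = Pt C"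
    using r1.ortho_is_vertex r2.ortho_is_vertex unfolding o unfolding s by blast+
  have H: "gen_orthocenter A B C P = ortho" unfolding P(2) by (rule gen_orthocenter_bpt)
  have sq: "p\<^sup>2 - \<sigma> \<noteq> 0" "q\<^sup>2 - \<sigma> \<noteq> 0" "r\<^sup>2 - \<sigma> \<noteq> 0"
    using assms(4) ortho_is_vertex vertex unfolding H by auto
  obtain x y z where xyz: "(x, y, z) \<noteq> 0" "X = bpt x y z" by (rule bpt_cases)
  then have "(y, z, x) \<noteq> 0" "(z, x, y) \<noteq> 0" by (auto simp: zero_prod_def)
  \<comment> \<open>The affine map sends each vertex to the trace belonging to it, so the order of the vertices is immaterial.\<close>
  have cm: "cevian_map B C A R = cevian_map A B C R" "cevian_map C A B R = cevian_map A B C R" for R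
    by (simp_all add: cevian_map_def conj_ac)
  let ?Q = "bpt (p * (q + r)) (q * (r + p)) (r * (p + q))"
  let ?D = "bpt 0 q r" and ?E = "bpt p 0 r" and ?F = "bpt p q 0"
  let ?T = "cevian_map A B C ortho"
  have "join (Pt A) (extend (affine_reflection (join (Pt A) ?Q) (join ?E ?F)) X) =
      join (Pt A) (extend ?T (cevian_trace A B C X))"
    unfolding xyz(2) by (rule cevian_lines_agree) (use X xyz sq in simp_all)
  moreover have "join (Pt B) (extend (affine_reflection (join (Pt B) ?Q) (join ?D ?F)) X) =
      join (Pt B) (extend ?T (cevian_trace B C A X))"
    using r1.cevian_lines_agree[of y z x] X xyz(2) sq \<open>(y, z, x) \<noteq> 0\<close>
    by (simp only: rot s o cm join_commute[of ?F ?D]) simp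
  moreover have "join (Pt C) (extend (affine_reflection (join (Pt C) ?Q) (join ?D ?E)) X) =
      join (Pt C) (extend ?T (cevian_trace C A B X))"
    using r2.cevian_lines_agree[of z x y] X xyz(2) sq \<open>(z, x, y) \<noteq> 0\<close>
    by (simp only: rot s o cm) simp
  ultimately show "gen_isogonal A B C P X = delta A B C (gen_orthocenter A B C P) X"
    unfolding gen_isogonal_def delta_def Let_def H
    unfolding P(2) isotomcomplement_bpt[OF nz] cevian_traces_bpt[OF nz] by simp
qed

end
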